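(* In LLFP (defined in the context): (1) if $\Gamma \vdash_\Sigma K$ then $K$ is strongly normalizing with respect to $\to_{\beta\mathcal{L}}$; (2) if $\Gamma \vdash_\Sigma \sigma : K$ then $\sigma$ is strongly normalizing with respect to $\to_{\beta\mathcal{L}}$; (3) if $\Gamma \vdash_\Sigma M : \sigma$ then $M$ is strongly normalizing with respect to $\to_{\beta\mathcal{L}}$.
   Context: LLFP (Lax Logical Framework) is parametrized by a set of predicates $\mathcal{P}$ on typing judgements $\Gamma \vdash_\Sigma N:\sigma$. Pseudo-syntax: signatures $\Sigma ::= \emptyset \mid \Sigma, a:K \mid \Sigma, c:\sigma$; contexts $\Gamma ::= \emptyset \mid \Gamma, x:\sigma$; kinds $K ::= \mathrm{Type} \mid \Pi x{:}\sigma.K$; families $\sigma,\tau,\rho ::= a \mid \Pi x{:}\sigma.\tau \mid \sigma N \mid \mathcal{L}^{\mathcal{P}}_{N,\sigma}[\rho]$; objects $M,N ::= c \mid x \mid \lambda x{:}\sigma.M \mid M N \mid \mathcal{L}^{\mathcal{P}}_{N,\sigma}[M] \mid \mathcal{U}^{\mathcal{P}}_{N,\sigma}[M]$. One-step $\beta\mathcal{L}$-reduction $\to_{\beta\mathcal{L}}$ is the closure under all constructors (all argument positions) of $(\lambda x{:}\sigma.M)N \to M[N/x]$ and $\mathcal{U}^{\mathcal{P}}_{N,\sigma}[\mathcal{L}^{\mathcal{P}}_{N,\sigma}[M]] \to M$; $=_{\beta\mathcal{L}}$ is its reflexive, symmetric, transitive closure. Judgements: $\Sigma\ \mathrm{sig}$,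 $\vdash_\Sigma \Gamma$, $\Gamma\vdash_\Sigma K$, $\Gamma\vdash_\Sigma \sigma:K$, $\Gamma\vdash_\Sigma M:\sigma$, derived by the rules: Signatures: $\emptyset\ \mathrm{sig}$; from $\vdash_\Sigma K$ and $a\notin\mathrm{Dom}(\Sigma)$ infer $\Sigma,a:K\ \mathrm{sig}$; from $\vdash_\Sigma\sigma:\mathrm{Type}$ and $c\notin\mathrm{Dom}(\Sigma)$ infer $\Sigma,c:\sigma\ \mathrm{sig}$. Contexts: from $\Sigma\ \mathrm{sig}$ infer $\vdash_\Sigma\emptyset$; from $\Gamma\vdash_\Sigma\sigma:\mathrm{Type}$ and $x\notin\mathrm{Dom}(\Gamma)$ infer $\vdash_\Sigma\Gamma,x:\sigma$. Kinds: from $\vdash_\Sigma\Gamma$ infer $\Gamma\vdash_\Sigma\mathrm{Type}$; from $\Gamma,x:\sigma\vdash_\Sigma K$ infer $\Gamma\vdash_\Sigma\Pi x{:}\sigma.K$. Families: from $\vdash_\Sigma\Gamma$, $a:K\in\Sigma$ infer $\Gamma\vdash_\Sigma a:K$; from $\Gamma,x:\sigma\vdash_\Sigma\tau:\mathrm{Type}$ infer $\Gamma\vdash_\Sigma\Pi x{:}\sigma.\tau:\mathrm{Type}$; from $\Gamma\vdash_\Sigma\sigma:\Pi x{:}\tau.K$ and $\Gamma\vdash_\Sigma N:\tau$ infer $\Gamma\vdash_\Sigma\sigma N:K[N/x]$; from $\Gamma\vdash_\Sigma\rho:\mathrm{Type}$ and $\Gamma\vdash_\Sigma N:\sigma$ infer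 $\Gamma\vdash_\Sigma\mathcal{L}^{\mathcal{P}}_{N,\sigma}[\rho]:\mathrm{Type}$; from $\Gamma\vdash_\Sigma\sigma:K$, $\Gamma\vdash_\Sigma K'$, $K=_{\beta\mathcal{L}}K'$ infer $\Gamma\vdash_\Sigma\sigma:K'$; (F-Guarded-Unlock) from $\Gamma,x:\tau\vdash_\Sigma\mathcal{L}^{\mathcal{P}}_{S,\sigma}[\rho]:\mathrm{Type}$, $\Gamma\vdash_\Sigma N:\mathcal{L}^{\mathcal{P}}_{S',\sigma'}[\tau]$, $\sigma=_{\beta\mathcal{L}}\sigma'$, $S=_{\beta\mathcal{L}}S'$ infer $\Gamma\vdash_\Sigma\mathcal{L}^{\mathcal{P}}_{S,\sigma}[\rho[\mathcal{U}^{\mathcal{P}}_{S',\sigma'}[N]/x]]:\mathrm{Type}$. Objects: from $\vdash_\Sigma\Gamma$, $c:\sigma\in\Sigma$ infer $\Gamma\vdash_\Sigma c:\sigma$; from $\vdash_\Sigma\Gamma$, $x:\sigma\in\Gamma$ infer $\Gamma\vdash_\Sigma x:\sigma$; from $\Gamma,x:\sigma\vdash_\Sigma M:\tau$ infer $\Gamma\vdash_\Sigma\lambda x{:}\sigma.M:\Pi x{:}\sigma.\tau$; from $\Gamma\vdash_\Sigma M:\Pi x{:}\sigma.\tau$ and $\Gamma\vdash_\Sigma N:\sigma$ infer $\Gamma\vdash_\Sigma MN:\tau[N/x]$; from $\Gamma\vdash_\Sigma M:\sigma$, $\Gamma\vdash_\Sigma\tau:\mathrm{Type}$, $\sigma=_{\beta\mathcal{L}}\tau$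 infer $\Gamma\vdash_\Sigma M:\tau$; (O-Lock) from $\Gamma\vdash_\Sigma M:\rho$ and $\Gamma\vdash_\Sigma N:\sigma$ infer $\Gamma\vdash_\Sigma\mathcal{L}^{\mathcal{P}}_{N,\sigma}[M]:\mathcal{L}^{\mathcal{P}}_{N,\sigma}[\rho]$; (O-Top-Unlock) from $\Gamma\vdash_\Sigma M:\mathcal{L}^{\mathcal{P}}_{N,\sigma}[\rho]$ and the (externally decided) fact that $\mathcal{P}(\Gamma\vdash_\Sigma N:\sigma)$ holds, infer $\Gamma\vdash_\Sigma\mathcal{U}^{\mathcal{P}}_{N,\sigma}[M]:\rho$; (O-Guarded-Unlock) from $\Gamma,x:\tau\vdash_\Sigma\mathcal{L}^{\mathcal{P}}_{S,\sigma}[M]:\mathcal{L}^{\mathcal{P}}_{S,\sigma}[\rho]$, $\Gamma\vdash_\Sigma N:\mathcal{L}^{\mathcal{P}}_{S',\sigma'}[\tau]$, $\sigma=_{\beta\mathcal{L}}\sigma'$, $S=_{\beta\mathcal{L}}S'$ infer $\Gamma\vdash_\Sigma\mathcal{L}^{\mathcal{P}}_{S,\sigma}[M[\mathcal{U}^{\mathcal{P}}_{S',\sigma'}[N]/x]]:\mathcal{L}^{\mathcal{P}}_{S,\sigma}[\rho[\mathcal{U}^{\mathcal{P}}_{S',\sigma'}[N]/x]]$.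
   Formalization: In the two Guarded-Unlock rules the variable x is required not to occur free in S or σ, so that the conclusion is well scoped over Γ; without this side condition the rules as written let x escape and a non-normalizing object becomes typable. *)

theory Defs
  imports Main
begin

(* The terms of LLFP in de Bruijn form, i.e. up to alpha-conversion: 'a and 'c are the names of
   family and object constants, 'p the names of the predicates that index locks.  Predicates
   occur in terms only through their names, because they are themselves predicates on judgements
   about such terms; the typing rules take the interpretation of the names as a parameter.
   Binders: the second argument of FPi, KPi and OLam. *)

datatype ('a, 'c, 'p) fam =
    FConst 'a
  | FPi "('a, 'c, 'p) fam" "('a, 'c, 'p) fam"
  | FApp "('a, 'c, 'p) fam" "('a, 'c, 'p) obj"
  | FLock 'p "('a, 'c, 'p) obj" "('a, 'c, 'p) fam" "('a, 'c, 'p) fam"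
and ('a, 'c, 'p) obj =
    OConst 'c
  | OVar nat
  | OLam "('a, 'c, 'p) fam" "('a, 'c, 'p) obj"
  | OApp "('a, 'c, 'p) obj" "('a, 'c, 'p) obj"
  | OLock 'p "('a, 'c, 'p) obj" "('a, 'c, 'p) fam" "('a, 'c, 'p) obj"
  | OUnlock 'p "('a, 'c, 'p) obj" "('a, 'c, 'p) fam" "('a, 'c, 'p) obj"

datatype ('a, 'c, 'p) kind =
    KType
  | KPi "('a, 'c, 'p) fam" "('a, 'c, 'p) kind"

(* lift d k adds d to the indices that are not bound within the term, i.e. those >= k. *)

primrec lift_fam :: "nat \<Rightarrow> nat \<Rightarrow> ('a, 'c, 'p) fam \<Rightarrow> ('a, 'c, 'p) fam"
  and lift_obj :: "nat \<Rightarrow> nat \<Rightarrow> ('a, 'c, 'p) obj \<Rightarrow> ('a, 'c, 'p) obj"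
where
  "lift_fam d k (FConst a) = FConst a"
| "lift_fam d k (FPi \<sigma> \<tau>) = FPi (lift_fam d k \<sigma>) (lift_fam d (Suc k) \<tau>)"
| "lift_fam d k (FApp \<sigma> N) = FApp (lift_fam d k \<sigma>) (lift_obj d k N)"
| "lift_fam d k (FLock P N \<sigma> \<rho>) = FLock P (lift_obj d k N) (lift_fam d k \<sigma>) (lift_fam d k \<rho>)"
| "lift_obj d k (OConst c) = OConst c"
| "lift_obj d k (OVar i) = OVar (if i < k then i else i + d)"
| "lift_obj d k (OLam \<sigma> M) = OLam (lift_fam d k \<sigma>) (lift_obj d (Suc k) M)"
| "lift_obj d k (OApp M N) = OApp (lift_obj d k M) (lift_obj d k N)"
| "lift_obj d k (OLock P N \<sigma> M) = OLock P (lift_obj d k N) (lift_fam d k \<sigma>) (lift_obj d k M)"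
| "lift_obj d k (OUnlock P N \<sigma> M) = OUnlock P (lift_obj d k N) (lift_fam d k \<sigma>) (lift_obj d k M)"

(* subst L k replaces the index k by L and lowers the indices above k, removing the binder. *)

primrec subst_fam :: "('a, 'c, 'p) obj \<Rightarrow> nat \<Rightarrow> ('a, 'c, 'p) fam \<Rightarrow> ('a, 'c, 'p) fam"
  and subst_obj :: "('a, 'c, 'p) obj \<Rightarrow> nat \<Rightarrow> ('a, 'c, 'p) obj \<Rightarrow> ('a, 'c, 'p) obj"
where
  "subst_fam L k (FConst a) = FConst a"
| "subst_fam L k (FPi \<sigma> \<tau>) = FPi (subst_fam L k \<sigma>) (subst_fam (lift_obj 1 0 L) (Suc k) \<tau>)"
| "subst_fam L k (FApp \<sigma> N) = FApp (subst_fam L k \<sigma>) (subst_obj L k N)"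
| "subst_fam L k (FLock P N \<sigma> \<rho>) =
     FLock P (subst_obj L k N) (subst_fam L k \<sigma>) (subst_fam L k \<rho>)"
| "subst_obj L k (OConst c) = OConst c"
| "subst_obj L k (OVar i) = (if i < k then OVar i else if i = k then L else OVar (i - 1))"
| "subst_obj L k (OLam \<sigma> M) = OLam (subst_fam L k \<sigma>) (subst_obj (lift_obj 1 0 L) (Suc k) M)"
| "subst_obj L k (OApp M N) = OApp (subst_obj L k M) (subst_obj L k N)"
| "subst_obj L k (OLock P N \<sigma> M) =
     OLock P (subst_obj L k N) (subst_fam L k \<sigma>) (subst_obj L k M)"
| "subst_obj L k (OUnlock P N \<sigma> M) =
     OUnlock P (subst_obj L k N) (subst_fam L k \<sigma>) (subst_obj L k M)"

primrec subst_kind :: "('a, 'c, 'p) obj \<Rightarrow> nat \<Rightarrow> ('a, 'c, 'p) kind \<Rightarrow> ('a, 'c, 'p) kind"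
where
  "subst_kind L k KType = KType"
| "subst_kind L k (KPi \<sigma> K) = KPi (subst_fam L k \<sigma>) (subst_kind (lift_obj 1 0 L) (Suc k) K)"

inductive red_fam :: "('a, 'c, 'p) fam \<Rightarrow> ('a, 'c, 'p) fam \<Rightarrow> bool"
  and red_obj :: "('a, 'c, 'p) obj \<Rightarrow> ('a, 'c, 'p) obj \<Rightarrow> bool"
where
  beta: "red_obj (OApp (OLam \<sigma> M) N) (subst_obj N 0 M)"
| unlock_lock: "red_obj (OUnlock P N \<sigma> (OLock P N \<sigma> M)) M"
| FPi1: "red_fam \<sigma> \<sigma>' \<Longrightarrow> red_fam (FPi \<sigma> \<tau>) (FPi \<sigma>' \<tau>)"
| FPi2: "red_fam \<tau> \<tau>' \<Longrightarrow> red_fam (FPi \<sigma> \<tau>) (FPi \<sigma> \<tau>')"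
| FApp1: "red_fam \<sigma> \<sigma>' \<Longrightarrow> red_fam (FApp \<sigma> N) (FApp \<sigma>' N)"
| FApp2: "red_obj N N' \<Longrightarrow> red_fam (FApp \<sigma> N) (FApp \<sigma> N')"
| FLock1: "red_obj N N' \<Longrightarrow> red_fam (FLock P N \<sigma> \<rho>) (FLock P N' \<sigma> \<rho>)"
| FLock2: "red_fam \<sigma> \<sigma>' \<Longrightarrow> red_fam (FLock P N \<sigma> \<rho>) (FLock P N \<sigma>' \<rho>)"
| FLock3: "red_fam \<rho> \<rho>' \<Longrightarrow> red_fam (FLock P N \<sigma> \<rho>) (FLock P N \<sigma> \<rho>')"
| OLam1: "red_fam \<sigma> \<sigma>' \<Longrightarrow> red_obj (OLam \<sigma> M) (OLam \<sigma>' M)"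
| OLam2: "red_obj M M' \<Longrightarrow> red_obj (OLam \<sigma> M) (OLam \<sigma> M')"
| OApp1: "red_obj M M' \<Longrightarrow> red_obj (OApp M N) (OApp M' N)"
| OApp2: "red_obj N N' \<Longrightarrow> red_obj (OApp M N) (OApp M N')"
| OLock1: "red_obj N N' \<Longrightarrow> red_obj (OLock P N \<sigma> M) (OLock P N' \<sigma> M)"
| OLock2: "red_fam \<sigma> \<sigma>' \<Longrightarrow> red_obj (OLock P N \<sigma> M) (OLock P N \<sigma>' M)"
| OLock3: "red_obj M M' \<Longrightarrow> red_obj (OLock P N \<sigma> M) (OLock P N \<sigma> M')"
| OUnlock1: "red_obj N N' \<Longrightarrow> red_obj (OUnlock P N \<sigma> M) (OUnlock P N' \<sigma> M)"
| OUnlock2: "red_fam \<sigma> \<sigma>' \<Longrightarrow> red_obj (OUnlock P N \<sigma> M) (OUnlock P N \<sigma>' M)"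
| OUnlock3: "red_obj M M' \<Longrightarrow> red_obj (OUnlock P N \<sigma> M) (OUnlock P N \<sigma> M')"

inductive red_kind :: "('a, 'c, 'p) kind \<Rightarrow> ('a, 'c, 'p) kind \<Rightarrow> bool"
where
  KPi1: "red_fam \<sigma> \<sigma>' \<Longrightarrow> red_kind (KPi \<sigma> K) (KPi \<sigma>' K)"
| KPi2: "red_kind K K' \<Longrightarrow> red_kind (KPi \<sigma> K) (KPi \<sigma> K')"

datatype ('a, 'c, 'p) decl =
    FamDecl 'a "('a, 'c, 'p) kind"
  | ObjDecl 'c "('a, 'c, 'p) fam"

(* The most recent declaration is the head of the list.  In a context, the i-th entry is the type
   of the variable i, given relative to the entries after it. *)

type_synonym ('a, 'c, 'p) sig = "('a, 'c, 'p) decl list"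
type_synonym ('a, 'c, 'p) ctx = "('a, 'c, 'p) fam list"

(* (\<Sigma>, \<Gamma>, N, \<sigma>) stands for \<Gamma> \<turnstile>_\<Sigma> N : \<sigma>, up to renaming of the variables in \<Gamma>. *)

type_synonym ('a, 'c, 'p) judgement =
  "('a, 'c, 'p) sig \<times> ('a, 'c, 'p) ctx \<times> ('a, 'c, 'p) obj \<times> ('a, 'c, 'p) fam"

(* Only closed kinds and families are declared in a well-formed signature, so the types of
   constants need no lifting when they are used in a context.  In the guarded unlock rules S and
   \<sigma> are lifted in the premise under the extended context: the conclusion, where S and \<sigma> occur
   unsubstituted in \<Gamma>, is in scope only if the removed variable is not free in them. *)

inductive sig_ok :: "('p \<Rightarrow> ('a, 'c, 'p) judgement \<Rightarrow> bool) \<Rightarrow> ('a, 'c, 'p) sig \<Rightarrow> bool"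
  and ctx_ok :: "('p \<Rightarrow> ('a, 'c, 'p) judgement \<Rightarrow> bool) \<Rightarrow> ('a, 'c, 'p) sig \<Rightarrow>
    ('a, 'c, 'p) ctx \<Rightarrow> bool"
  and kind_ok :: "('p \<Rightarrow> ('a, 'c, 'p) judgement \<Rightarrow> bool) \<Rightarrow> ('a, 'c, 'p) sig \<Rightarrow>
    ('a, 'c, 'p) ctx \<Rightarrow> ('a, 'c, 'p) kind \<Rightarrow> bool"
  and has_kind :: "('p \<Rightarrow> ('a, 'c, 'p) judgement \<Rightarrow> bool) \<Rightarrow> ('a, 'c, 'p) sig \<Rightarrow>
    ('a, 'c, 'p) ctx \<Rightarrow> ('a, 'c, 'p) fam \<Rightarrow> ('a, 'c, 'p) kind \<Rightarrow> bool"
  and has_type :: "('p \<Rightarrow> ('a, 'c, 'p) judgement \<Rightarrow> bool) \<Rightarrow> ('a, 'c, 'p) sig \<Rightarrow>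
    ('a, 'c, 'p) ctx \<Rightarrow> ('a, 'c, 'p) obj \<Rightarrow> ('a, 'c, 'p) fam \<Rightarrow> bool"
  for holds :: "'p \<Rightarrow> ('a, 'c, 'p) judgement \<Rightarrow> bool"
where
  S_Empty: "sig_ok holds []"
| S_Kind: "kind_ok holds \<Sigma> [] K \<Longrightarrow> (\<And>K'. FamDecl a K' \<notin> set \<Sigma>) \<Longrightarrow>
    sig_ok holds (FamDecl a K # \<Sigma>)"
| S_Type: "has_kind holds \<Sigma> [] \<sigma> KType \<Longrightarrow> (\<And>\<sigma>'. ObjDecl c \<sigma>' \<notin> set \<Sigma>) \<Longrightarrow>
    sig_ok holds (ObjDecl c \<sigma> # \<Sigma>)"

| C_Empty: "sig_ok holds \<Sigma> \<Longrightarrow> ctx_ok holds \<Sigma> []"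
| C_Type: "has_kind holds \<Sigma> \<Gamma> \<sigma> KType \<Longrightarrow> ctx_ok holds \<Sigma> (\<sigma> # \<Gamma>)"

| K_Type: "ctx_ok holds \<Sigma> \<Gamma> \<Longrightarrow> kind_ok holds \<Sigma> \<Gamma> KType"
| K_Pi: "kind_ok holds \<Sigma> (\<sigma> # \<Gamma>) K \<Longrightarrow> kind_ok holds \<Sigma> \<Gamma> (KPi \<sigma> K)"

| F_Const: "ctx_ok holds \<Sigma> \<Gamma> \<Longrightarrow> FamDecl a K \<in> set \<Sigma> \<Longrightarrow> has_kind holds \<Sigma> \<Gamma> (FConst a) K"
| F_Pi: "has_kind holds \<Sigma> (\<sigma> # \<Gamma>) \<tau> KType \<Longrightarrow> has_kind holds \<Sigma> \<Gamma> (FPi \<sigma> \<tau>) KType"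
| F_App: "has_kind holds \<Sigma> \<Gamma> \<sigma> (KPi \<tau> K) \<Longrightarrow> has_type holds \<Sigma> \<Gamma> N \<tau> \<Longrightarrow>
    has_kind holds \<Sigma> \<Gamma> (FApp \<sigma> N) (subst_kind N 0 K)"
| F_Lock: "has_kind holds \<Sigma> \<Gamma> \<rho> KType \<Longrightarrow> has_type holds \<Sigma> \<Gamma> N \<sigma> \<Longrightarrow>
    has_kind holds \<Sigma> \<Gamma> (FLock P N \<sigma> \<rho>) KType"
| F_Conv: "has_kind holds \<Sigma> \<Gamma> \<sigma> K \<Longrightarrow> kind_ok holds \<Sigma> \<Gamma> K' \<Longrightarrow> equivclp red_kind K K' \<Longrightarrow>
    has_kind holds \<Sigma> \<Gamma> \<sigma> K'"
| F_Guarded_Unlock: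
    "has_kind holds \<Sigma> (\<tau> # \<Gamma>) (FLock P (lift_obj 1 0 S) (lift_fam 1 0 \<sigma>) \<rho>) KType \<Longrightarrow>
     has_type holds \<Sigma> \<Gamma> N (FLock P S' \<sigma>' \<tau>) \<Longrightarrow>
     equivclp red_fam \<sigma> \<sigma>' \<Longrightarrow> equivclp red_obj S S' \<Longrightarrow>
     has_kind holds \<Sigma> \<Gamma> (FLock P S \<sigma> (subst_fam (OUnlock P S' \<sigma>' N) 0 \<rho>)) KType"

| O_Const: "ctx_ok holds \<Sigma> \<Gamma> \<Longrightarrow> ObjDecl c \<sigma> \<in> set \<Sigma> \<Longrightarrow> has_type holds \<Sigma> \<Gamma> (OConst c) \<sigma>"
| O_Var: "ctx_ok holds \<Sigma> \<Gamma> \<Longrightarrow> i < length \<Gamma> \<Longrightarrow>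
    has_type holds \<Sigma> \<Gamma> (OVar i) (lift_fam (Suc i) 0 (\<Gamma> ! i))"
| O_Abs: "has_type holds \<Sigma> (\<sigma> # \<Gamma>) M \<tau> \<Longrightarrow> has_type holds \<Sigma> \<Gamma> (OLam \<sigma> M) (FPi \<sigma> \<tau>)"
| O_App: "has_type holds \<Sigma> \<Gamma> M (FPi \<sigma> \<tau>) \<Longrightarrow> has_type holds \<Sigma> \<Gamma> N \<sigma> \<Longrightarrow>
    has_type holds \<Sigma> \<Gamma> (OApp M N) (subst_fam N 0 \<tau>)"
| O_Conv: "has_type holds \<Sigma> \<Gamma> M \<sigma> \<Longrightarrow> has_kind holds \<Sigma> \<Gamma> \<tau> KType \<Longrightarrow> equivclp red_fam \<sigma> \<tau> \<Longrightarrow>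
    has_type holds \<Sigma> \<Gamma> M \<tau>"
| O_Lock: "has_type holds \<Sigma> \<Gamma> M \<rho> \<Longrightarrow> has_type holds \<Sigma> \<Gamma> N \<sigma> \<Longrightarrow>
    has_type holds \<Sigma> \<Gamma> (OLock P N \<sigma> M) (FLock P N \<sigma> \<rho>)"
| O_Top_Unlock: "has_type holds \<Sigma> \<Gamma> M (FLock P N \<sigma> \<rho>) \<Longrightarrow> holds P (\<Sigma>, \<Gamma>, N, \<sigma>) \<Longrightarrow>
    has_type holds \<Sigma> \<Gamma> (OUnlock P N \<sigma> M) \<rho>"
| O_Guarded_Unlock:
    "has_type holds \<Sigma> (\<tau> # \<Gamma>) (OLock P (lift_obj 1 0 S) (lift_fam 1 0 \<sigma>) M)
       (FLock P (lift_obj 1 0 S) (lift_fam 1 0 \<sigma>) \<rho>) \<Longrightarrow>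
     has_type holds \<Sigma> \<Gamma> N (FLock P S' \<sigma>' \<tau>) \<Longrightarrow>
     equivclp red_fam \<sigma> \<sigma>' \<Longrightarrow> equivclp red_obj S S' \<Longrightarrow>
     has_type holds \<Sigma> \<Gamma> (OLock P S \<sigma> (subst_obj (OUnlock P S' \<sigma>' N) 0 M))
       (FLock P S \<sigma> (subst_fam (OUnlock P S' \<sigma>' N) 0 \<rho>))"

end

theory Submission
  imports Defs
begin

text \<open>
  Families contain no redex at their root, so erasing objects from families gives simple types
  (with a unary constructor for locks) that are invariant under substitution and conversion.
  Girard's reducibility method over these simple types, applied directly to the raw objects,
  therefore gives strong normalization.  The rules for unlocks and applications extract
  normalization of the annotations and of the result type from the type of a premise;
  hence the induction also shows that the types themselves are hereditarily reducible.
\<close>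

section \<open>Simultaneous substitution\<close>

definition up :: "(nat \<Rightarrow> ('a, 'c, 'p) obj) \<Rightarrow> nat \<Rightarrow> ('a, 'c, 'p) obj" where
  "up \<gamma> = case_nat (OVar 0) (\<lambda>i. lift_obj 1 0 (\<gamma> i))"

text \<open>Replacing all free indices at once lets an environment be a plain function on indices,
  with one composition law instead of commutation laws at every depth.\<close>

primrec psubst_fam :: "(nat \<Rightarrow> ('a, 'c, 'p) obj) \<Rightarrow> ('a, 'c, 'p) fam \<Rightarrow> ('a, 'c, 'p) fam"
  and psubst_obj :: "(nat \<Rightarrow> ('a, 'c, 'p) obj) \<Rightarrow> ('a, 'c, 'p) obj \<Rightarrow> ('a, 'c, 'p) obj"
where
  "psubst_fam \<gamma> (FConst a) = FConst a"
| "psubst_fam \<gamma> (FPi \<sigma> \<tau>) = FPi (psubst_fam \<gamma> \<sigma>) (psubst_fam (up \<gamma>) \<tau>)"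
| "psubst_fam \<gamma> (FApp \<sigma> N) = FApp (psubst_fam \<gamma> \<sigma>) (psubst_obj \<gamma> N)"
| "psubst_fam \<gamma> (FLock P N \<sigma> \<rho>) = FLock P (psubst_obj \<gamma> N) (psubst_fam \<gamma> \<sigma>) (psubst_fam \<gamma> \<rho>)"
| "psubst_obj \<gamma> (OConst c) = OConst c"
| "psubst_obj \<gamma> (OVar i) = \<gamma> i"
| "psubst_obj \<gamma> (OLam \<sigma> M) = OLam (psubst_fam \<gamma> \<sigma>) (psubst_obj (up \<gamma>) M)"
| "psubst_obj \<gamma> (OApp M N) = OApp (psubst_obj \<gamma> M) (psubst_obj \<gamma> N)"
| "psubst_obj \<gamma> (OLock P N \<sigma> M) = OLock P (psubst_obj \<gamma> N) (psubst_fam \<gamma> \<sigma>) (psubst_obj \<gamma> M)"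
| "psubst_obj \<gamma> (OUnlock P N \<sigma> M) = OUnlock P (psubst_obj \<gamma> N) (psubst_fam \<gamma> \<sigma>) (psubst_obj \<gamma> M)"

primrec psubst_kind :: "(nat \<Rightarrow> ('a, 'c, 'p) obj) \<Rightarrow> ('a, 'c, 'p) kind \<Rightarrow> ('a, 'c, 'p) kind" where
  "psubst_kind \<gamma> KType = KType"
| "psubst_kind \<gamma> (KPi \<sigma> K) = KPi (psubst_fam \<gamma> \<sigma>) (psubst_kind (up \<gamma>) K)"

section \<open>Lifting and single substitution as simultaneous substitutions\<close>

lemma up_var: "up (\<lambda>i. OVar (r i)) = (\<lambda>i. OVar (case_nat 0 (\<lambda>i. Suc (r i)) i))"
  by (auto simp: up_def fun_eq_iff split: nat.split)

lemma up_lift: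
  "up (\<lambda>i. OVar (if i < k then i else i + d)) = (\<lambda>i. OVar (if i < Suc k then i else i + d))"
  by (auto simp: up_def fun_eq_iff split: nat.split)

lemma lift_eq_psubst:
  fixes \<sigma> :: "('a, 'c, 'p) fam" and M :: "('a, 'c, 'p) obj"
  shows "lift_fam d k \<sigma> = psubst_fam (\<lambda>i. OVar (if i < k then i else i + d)) \<sigma>"
    "lift_obj d k M = psubst_obj (\<lambda>i. OVar (if i < k then i else i + d)) M"
  by (induction \<sigma> and M arbitrary: k and k) (simp_all only: lift_fam.simps lift_obj.simps
      psubst_fam.simps psubst_obj.simps up_lift)

lemma up_subst:
  "up (\<lambda>i. if i < k then OVar i else if i = k then L else OVar (i - 1)) =
   (\<lambda>i. if i < Suc k then OVar i else if i = Suc k then lift_obj 1 0 L else OVar (i - 1))"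
  by (auto simp: up_def fun_eq_iff split: nat.split)

lemma subst_eq_psubst:
  "subst_fam L k \<sigma> = psubst_fam (\<lambda>i. if i < k then OVar i else if i = k then L else OVar (i - 1)) \<sigma>"
  "subst_obj L k M = psubst_obj (\<lambda>i. if i < k then OVar i else if i = k then L else OVar (i - 1)) M"
  by (induction \<sigma> and M arbitrary: L k and L k) (simp_all only: subst_fam.simps subst_obj.simps
      psubst_fam.simps psubst_obj.simps up_subst)

lemma subst0_eq_psubst:
  "subst_fam L 0 = psubst_fam (case_nat L OVar)"
  "subst_obj L 0 = psubst_obj (case_nat L OVar)"
proof -
  have "(\<lambda>i. if i < 0 then OVar i else if i = 0 then L else OVar (i - 1)) = case_nat L OVar"
    by (auto simp: fun_eq_iff split: nat.split)
  then show "subst_fam L 0 = psubst_fam (case_nat L OVar)"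
    "subst_obj L 0 = psubst_obj (case_nat L OVar)"
    by (simp_all only: fun_eq_iff subst_eq_psubst) simp_all
qed

lemma lift0_eq_psubst:
  "lift_fam d 0 = psubst_fam (\<lambda>i. OVar (i + d))"
  "lift_obj d 0 = psubst_obj (\<lambda>i. OVar (i + d))"
  by (simp_all add: fun_eq_iff lift_eq_psubst)

lemma up_OVar: "up OVar = OVar"
  by (auto simp: up_def fun_eq_iff split: nat.split)

lemma psubst_OVar:
  fixes \<sigma> :: "('a, 'c, 'p) fam" and M :: "('a, 'c, 'p) obj"
  shows "psubst_fam OVar \<sigma> = \<sigma>"
    "psubst_obj OVar M = M"
  by (induction \<sigma> and M) (simp_all add: up_OVar)

lemma psubst_kind_OVar: "psubst_kind OVar K = K"
  by (induction K) (simp_all add: up_OVar psubst_OVar)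

section \<open>Composition laws for substitutions\<close>

lemma up_comp_ren: "(\<lambda>i. up \<gamma> (case_nat 0 (\<lambda>i. Suc (r i)) i)) = up (\<lambda>i. \<gamma> (r i))"
  by (auto simp: up_def fun_eq_iff split: nat.split)

text \<open>As \<open>up\<close> itself contains a lifting, composition is proved first with a
  renaming inside, then with one outside (\<open>ren_psubst\<close>), and only then for arbitrary
  substitutions (\<open>psubst_psubst\<close>).\<close>

lemma psubst_ren:
  "psubst_fam \<gamma> (psubst_fam (\<lambda>i. OVar (r i)) \<sigma>) = psubst_fam (\<lambda>i. \<gamma> (r i)) \<sigma>"
  "psubst_obj \<gamma> (psubst_obj (\<lambda>i. OVar (r i)) M) = psubst_obj (\<lambda>i. \<gamma> (r i)) M"
  by (induction \<sigma> and M arbitrary: \<gamma> r and \<gamma> r) (simp_all add: up_var up_comp_ren)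

lemma ren_comp_up:
  "(\<lambda>i. psubst_obj (\<lambda>i. OVar (case_nat 0 (\<lambda>i. Suc (r i)) i)) (up \<gamma> i)) =
   up (\<lambda>i. psubst_obj (\<lambda>i. OVar (r i)) (\<gamma> i))"
  by (auto simp: up_def fun_eq_iff lift0_eq_psubst psubst_ren split: nat.split)

lemma ren_psubst:
  "psubst_fam (\<lambda>i. OVar (r i)) (psubst_fam \<gamma> \<sigma>) = psubst_fam (\<lambda>i. psubst_obj (\<lambda>i. OVar (r i)) (\<gamma> i)) \<sigma>"
  "psubst_obj (\<lambda>i. OVar (r i)) (psubst_obj \<gamma> M) = psubst_obj (\<lambda>i. psubst_obj (\<lambda>i. OVar (r i)) (\<gamma> i)) M"
  by (induction \<sigma> and M arbitrary: \<gamma> r and \<gamma> r) (simp_all add: up_var ren_comp_up)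

lemma psubst_comp_up: "(\<lambda>i. psubst_obj (up \<gamma>) (up \<delta> i)) = up (\<lambda>i. psubst_obj \<gamma> (\<delta> i))"
proof
  fix i
  show "psubst_obj (up \<gamma>) (up \<delta> i) = up (\<lambda>i. psubst_obj \<gamma> (\<delta> i)) i"
    by (cases i) (simp_all add: up_def lift0_eq_psubst psubst_ren ren_psubst)
qed

lemma psubst_psubst:
  "psubst_fam \<gamma> (psubst_fam \<delta> \<sigma>) = psubst_fam (\<lambda>i. psubst_obj \<gamma> (\<delta> i)) \<sigma>"
  "psubst_obj \<gamma> (psubst_obj \<delta> M) = psubst_obj (\<lambda>i. psubst_obj \<gamma> (\<delta> i)) M"
  by (induction \<sigma> and M arbitrary: \<gamma> \<delta> and \<gamma> \<delta>) (simp_all add: psubst_comp_up)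

lemma psubst_kind_psubst_kind:
  "psubst_kind \<gamma> (psubst_kind \<delta> K) = psubst_kind (\<lambda>i. psubst_obj \<gamma> (\<delta> i)) K"
  by (induction K arbitrary: \<gamma> \<delta>) (simp_all add: psubst_comp_up psubst_psubst)

lemma psubst_comp_case_nat:
  "(\<lambda>i. psubst_obj \<gamma> (case_nat N OVar i)) = case_nat (psubst_obj \<gamma> N) \<gamma>"
  by (auto simp: fun_eq_iff split: nat.split)

lemma case_nat_comp_up: "(\<lambda>i. psubst_obj (case_nat N OVar) (up \<gamma> i)) = case_nat N \<gamma>"
  by (auto simp: up_def fun_eq_iff lift0_eq_psubst psubst_ren psubst_OVar split: nat.split)

lemma psubst_subst0:
  "psubst_fam \<gamma> (subst_fam N 0 \<sigma>) = psubst_fam (case_nat (psubst_obj \<gamma> N) \<gamma>) \<sigma>"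
  "psubst_obj \<gamma> (subst_obj N 0 M) = psubst_obj (case_nat (psubst_obj \<gamma> N) \<gamma>) M"
  by (simp_all add: subst0_eq_psubst psubst_psubst psubst_comp_case_nat)

text \<open>Instantiating the bound variable cancels the lifting done by \<open>up\<close>:
  contracting a substituted redex is evaluating its body in the extended environment.\<close>

lemma subst0_psubst_up:
  "subst_fam N 0 (psubst_fam (up \<gamma>) \<sigma>) = psubst_fam (case_nat N \<gamma>) \<sigma>"
  "subst_obj N 0 (psubst_obj (up \<gamma>) M) = psubst_obj (case_nat N \<gamma>) M"
  by (simp_all add: subst0_eq_psubst psubst_psubst case_nat_comp_up)

lemma red_psubst:
  "red_fam \<sigma> \<sigma>' \<Longrightarrow> red_fam (psubst_fam \<gamma> \<sigma>) (psubst_fam \<gamma> \<sigma>')"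
  "red_obj M M' \<Longrightarrow> red_obj (psubst_obj \<gamma> M) (psubst_obj \<gamma> M')"
proof (induction arbitrary: \<gamma> and \<gamma> rule: red_fam_red_obj.inducts)
  case (beta \<sigma> M N)
  show ?case
    \<comment> \<open>Contracting before or after substituting evaluates \<open>M\<close> under
      \<open>case_nat (psubst_obj \<gamma> N) \<gamma>\<close> either way.\<close>
    using red_fam_red_obj.beta[of "psubst_fam \<gamma> \<sigma>" "psubst_obj (up \<gamma>) M" "psubst_obj \<gamma> N"]
    by (simp add: psubst_subst0 subst0_psubst_up)
qed (auto intro: red_fam_red_obj.intros)

lemma red_psubst_kind: "red_kind K K' \<Longrightarrow> red_kind (psubst_kind \<gamma> K) (psubst_kind \<gamma> K')"
  by (induction arbitrary: \<gamma> rule: red_kind.induct) (auto intro: red_kind.intros red_psubst)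

section \<open>Strong normalization\<close>

definition SN :: "('t \<Rightarrow> 't \<Rightarrow> bool) \<Rightarrow> 't \<Rightarrow> bool" where
  "SN r x = termip r x"

lemma SN_I: "(\<And>y. r x y \<Longrightarrow> SN r y) \<Longrightarrow> SN r x"
  unfolding SN_def by (rule accp.accI) simp

lemma SN_step: "SN r x \<Longrightarrow> r x y \<Longrightarrow> SN r y"
  unfolding SN_def by (erule accp_downward) simp

lemma SN_induct [consumes 1, case_names step]:
  assumes "SN r x"
    and step: "\<And>x. SN r x \<Longrightarrow> (\<And>y. r x y \<Longrightarrow> P y) \<Longrightarrow> P x"
  shows "P x"
  using assms(1) unfolding SN_def
proof (induction rule: accp.induct)
  case (accI x)
  show ?case
  proof (rule step)
    show "SN r x" unfolding SN_def using accI(1) by (rule accp.accI)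
    show "P y" if "r x y" for y using that by (intro accI(2) conversepI)
  qed
qed

text \<open>Nested inductions: one component steps while the other is fixed, and the outer
  hypothesis holds for every normalizing \<open>y\<close>.\<close>

lemma SN_induct2 [consumes 2, case_names step]:
  assumes "SN r x" "SN s y"
    and step: "\<And>x y. SN r x \<Longrightarrow> SN s y \<Longrightarrow> (\<And>x'. r x x' \<Longrightarrow> P x' y) \<Longrightarrow>
      (\<And>y'. s y y' \<Longrightarrow> P x y') \<Longrightarrow> P x y"
  shows "P x y"
  using assms(1,2)
proof (induction x arbitrary: y rule: SN_induct)
  case (step x)
  note outer = step
  from outer(3) show ?case
  proof (induction y rule: SN_induct)
    case (step y)
    show ?case by (rule assms(3)) (use outer(1,2) step in blast)+
  qed
qed

lemma SN_induct3 [consumes 3, case_names step]: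
  assumes "SN r x" "SN s y" "SN t z"
    and step: "\<And>x y z. SN r x \<Longrightarrow> SN s y \<Longrightarrow> SN t z \<Longrightarrow>
      (\<And>x'. r x x' \<Longrightarrow> P x' y z) \<Longrightarrow> (\<And>y'. s y y' \<Longrightarrow> P x y' z) \<Longrightarrow>
      (\<And>z'. t z z' \<Longrightarrow> P x y z') \<Longrightarrow> P x y z"
  shows "P x y z"
  using assms(1-3)
proof (induction x arbitrary: y z rule: SN_induct)
  case (step x)
  note outer = step
  from outer(3,4) show ?case
  proof (induction rule: SN_induct2)
    case (step y z)
    show ?case by (rule assms(4)) (use outer(1,2) step in blast)+
  qed
qed

text \<open>An infinite reduction from \<open>x\<close> would be carried by \<open>f\<close> to one
  from \<open>f x\<close>.\<close>

lemma SN_reflect: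
  assumes "SN s (f x)" and sim: "\<And>x y. r x y \<Longrightarrow> s (f x) (f y)"
  shows "SN r x"
  using assms(1)
proof (induction "f x" arbitrary: x rule: SN_induct)
  case (step x)
  show ?case by (rule SN_I) (rule step.hyps(2)[OF sim])
qed

section \<open>Inversion rules, and normalization of constructors that form no redex\<close>

inductive_cases red_fam_elims:
  "red_fam (FConst a) \<rho>"
  "red_fam (FPi \<sigma> \<tau>) \<rho>"
  "red_fam (FApp \<sigma> N) \<rho>"
  "red_fam (FLock P N \<sigma> \<tau>) \<rho>"

inductive_cases red_obj_elims:
  "red_obj (OConst c) M'"
  "red_obj (OVar i) M'"
  "red_obj (OLam \<sigma> M) M'"
  "red_obj (OApp M N) M'"
  "red_obj (OLock P N \<sigma> M) M'"
  "red_obj (OUnlock P N \<sigma> M) M'"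

inductive_cases red_kind_elims:
  "red_kind KType K'"
  "red_kind (KPi \<sigma> K) K'"

lemma SN_FConst: "SN red_fam (FConst a)"
  by (rule SN_I) (auto elim: red_fam_elims)

lemma SN_OVar: "SN red_obj (OVar i)"
  by (rule SN_I) (auto elim: red_obj_elims)

lemma SN_KType: "SN red_kind KType"
  by (rule SN_I) (auto elim: red_kind_elims)

lemma SN_FPi: "SN red_fam \<sigma> \<Longrightarrow> SN red_fam \<tau> \<Longrightarrow> SN red_fam (FPi \<sigma> \<tau>)"
  by (induction rule: SN_induct2) (rule SN_I, auto elim: red_fam_elims)

lemma SN_FApp: "SN red_fam \<sigma> \<Longrightarrow> SN red_obj N \<Longrightarrow> SN red_fam (FApp \<sigma> N)"
  by (induction rule: SN_induct2) (rule SN_I, auto elim: red_fam_elims)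

lemma SN_FLock:
  "SN red_obj N \<Longrightarrow> SN red_fam \<sigma> \<Longrightarrow> SN red_fam \<rho> \<Longrightarrow> SN red_fam (FLock P N \<sigma> \<rho>)"
  by (induction rule: SN_induct3) (rule SN_I, auto elim: red_fam_elims)

lemma SN_KPi: "SN red_fam \<sigma> \<Longrightarrow> SN red_kind K \<Longrightarrow> SN red_kind (KPi \<sigma> K)"
  by (induction rule: SN_induct2) (rule SN_I, auto elim: red_kind_elims)

lemma SN_OLam: "SN red_fam \<sigma> \<Longrightarrow> SN red_obj M \<Longrightarrow> SN red_obj (OLam \<sigma> M)"
  by (induction rule: SN_induct2) (rule SN_I, auto elim: red_obj_elims)

lemma SN_OLock:
  "SN red_obj N \<Longrightarrow> SN red_fam \<sigma> \<Longrightarrow> SN red_obj M \<Longrightarrow> SN red_obj (OLock P N \<sigma> M)"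
  by (induction rule: SN_induct3) (rule SN_I, auto elim: red_obj_elims)

text \<open>
  This reflection lets normalization under a binder follow from that of an instance, so that
  reducibility need not be closed under weakening.
\<close>

lemma SN_psubst_reflect:
  "SN red_fam (psubst_fam \<gamma> \<sigma>) \<Longrightarrow> SN red_fam \<sigma>"
  "SN red_obj (psubst_obj \<gamma> M) \<Longrightarrow> SN red_obj M"
  "SN red_kind (psubst_kind \<gamma> K) \<Longrightarrow> SN red_kind K"
proof -
  show "SN red_fam (psubst_fam \<gamma> \<sigma>) \<Longrightarrow> SN red_fam \<sigma>"
    by (erule SN_reflect[where f = "psubst_fam \<gamma>"]) (rule red_psubst)
  show "SN red_obj (psubst_obj \<gamma> M) \<Longrightarrow> SN red_obj M"
    by (erule SN_reflect[where f = "psubst_obj \<gamma>"]) (rule red_psubst)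
  show "SN red_kind (psubst_kind \<gamma> K) \<Longrightarrow> SN red_kind K"
    by (erule SN_reflect[where f = "psubst_kind \<gamma>"]) (rule red_psubst_kind)
qed

section \<open>Reducibility\<close>

datatype sty = Base | Arr sty sty | Lk sty

text \<open>Girard's relation over erased types, on raw objects. As \<open>Lk\<close> remembers
  neither predicate nor annotations of a lock, its clause tests unlocks with every predicate name
  and all normalizing annotations.\<close>

primrec Red :: "sty \<Rightarrow> ('a, 'c, 'p) obj \<Rightarrow> bool" where
  "Red Base M = SN red_obj M"
| "Red (Arr A B) M = (\<forall>N. Red A N \<longrightarrow> Red B (OApp M N))"
| "Red (Lk A) M =
     (\<forall>P N \<sigma>. SN red_obj N \<longrightarrow> SN red_fam \<sigma> \<longrightarrow> Red A (OUnlock P N \<sigma> M))"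

text \<open>Objects other than introduction forms: applied or unlocked, they create no root redex.
  Redexes count as neutral, so they can be handled through their reducts.\<close>

fun neutral :: "('a, 'c, 'p) obj \<Rightarrow> bool" where
  "neutral (OLam \<sigma> M) = False"
| "neutral (OLock P N \<sigma> M) = False"
| "neutral M = True"

text \<open>Girard's three conditions depend on each other: normalization at \<open>Arr\<close>
  applies the object to a variable, reducible by the third condition at the argument type, and the
  third condition at \<open>Arr\<close> needs arguments to normalize.\<close>

lemma Red_candidate:
  fixes M :: "('a, 'c, 'p) obj"
  shows "(Red A M \<longrightarrow> SN red_obj M) \<and>
    (\<forall>M'. Red A M \<longrightarrow> red_obj M M' \<longrightarrow> Red A M') \<and>
    (neutral M \<longrightarrow> (\<forall>M'. red_obj M M' \<longrightarrow> Red A M') \<longrightarrow> Red A M)"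
proof (induction A arbitrary: M)
  case Base
  have "SN red_obj M" if "\<forall>M'. red_obj M M' \<longrightarrow> SN red_obj M'" using that by (blast intro: SN_I)
  then show ?case unfolding Red.simps by (blast dest: SN_step)
next
  case (Arr A B)
  have A_SN: "Red A M \<Longrightarrow> SN red_obj M"
    and A_step: "Red A M \<Longrightarrow> red_obj M M' \<Longrightarrow> Red A M'"
    and A_neutral: "neutral M \<Longrightarrow> (\<And>M'. red_obj M M' \<Longrightarrow> Red A M') \<Longrightarrow> Red A M"
    for M M' :: "('a, 'c, 'p) obj"
    using Arr.IH(1) by blast+
  have B_SN: "Red B M \<Longrightarrow> SN red_obj M"
    and B_step: "Red B M \<Longrightarrow> red_obj M M' \<Longrightarrow> Red B M'"
    and B_neutral: "neutral M \<Longrightarrow> (\<And>M'. red_obj M M' \<Longrightarrow> Red B M') \<Longrightarrow> Red B M"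
    for M M' :: "('a, 'c, 'p) obj"
    using Arr.IH(2) by blast+
  have var: "Red A (OVar 0 :: ('a, 'c, 'p) obj)"
    by (rule A_neutral) (auto elim: red_obj_elims(2))
  have "SN red_obj M" if "Red (Arr A B) M"
  \<comment> \<open>Any reducible argument would serve; \<open>OVar 0\<close> is one, and the steps
    of \<open>M\<close> are simulated in head position.\<close>
  proof (rule SN_reflect[where f = "\<lambda>M. OApp M (OVar 0)"])
    show "SN red_obj (OApp M (OVar 0))"
      by (rule B_SN) (use that var in simp)
  qed (rule OApp1)
  moreover have "Red (Arr A B) M'" if "Red (Arr A B) M" "red_obj M M'" for M'
    using that unfolding Red.simps by (blast intro: OApp1 B_step)
  moreover have "Red (Arr A B) M"
    if neut: "neutral M" and red: "\<And>M'. red_obj M M' \<Longrightarrow> Red (Arr A B) M'"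
    unfolding Red.simps
  proof (intro allI impI)
    fix N :: "('a, 'c, 'p) obj"
    assume "Red A N"
    \<comment> \<open>With a neutral head every step is inside \<open>M\<close>, covered by
      \<open>red\<close>, or inside \<open>N\<close>, covered by this induction.\<close>
    from A_SN[OF this] this show "Red B (OApp M N)"
    proof (induction N rule: SN_induct)
      case (step N)
      show ?case
      proof (rule B_neutral)
        fix T
        assume "red_obj (OApp M N) T"
        then show "Red B T"
          using neut red step by (cases rule: red_obj_elims(4)) (auto intro: A_step)
      qed simp
    qed
  qed
  ultimately show ?case by blast
next
  case (Lk A)
  have A_SN: "Red A M \<Longrightarrow> SN red_obj M"
    and A_step: "Red A M \<Longrightarrow> red_obj M M' \<Longrightarrow> Red A M'"
    and A_neutral: "neutral M \<Longrightarrow> (\<And>M'. red_obj M M' \<Longrightarrow> Red A M') \<Longrightarrow> Red A M"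
    for M M' :: "('a, 'c, 'p) obj"
    using Lk.IH by blast+
  have "SN red_obj M" if "Red (Lk A) M"
  \<comment> \<open>\<open>undefined\<close> is an arbitrary predicate name and family constant;
    both annotations are normal, so the clause for \<open>Lk\<close> applies.\<close>
  proof (rule SN_reflect[where f = "OUnlock undefined (OVar 0) (FConst undefined)"])
    show "SN red_obj (OUnlock undefined (OVar 0) (FConst undefined) M)"
      by (rule A_SN) (use that in \<open>simp add: SN_OVar SN_FConst\<close>)
  qed (rule OUnlock3)
  moreover have "Red (Lk A) M'" if "Red (Lk A) M" "red_obj M M'" for M'
    using that unfolding Red.simps by (blast intro: OUnlock3 A_step)
  moreover have "Red (Lk A) M"
    if neut: "neutral M" and red: "\<And>M'. red_obj M M' \<Longrightarrow> Red (Lk A) M'"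
    unfolding Red.simps
  proof (intro allI impI)
    fix P :: 'p and N :: "('a, 'c, 'p) obj" and \<sigma> :: "('a, 'c, 'p) fam"
    assume "SN red_obj N" "SN red_fam \<sigma>"
    then show "Red A (OUnlock P N \<sigma> M)"
    proof (induction rule: SN_induct2)
      case (step N \<sigma>)
      show ?case
      proof (rule A_neutral)
        fix T
        assume "red_obj (OUnlock P N \<sigma> M) T"
        then show "Red A T"
          using neut red step by (cases rule: red_obj_elims(6)) auto
      qed simp
    qed
  qed
  ultimately show ?case by blast
qed

lemma Red_SN: "Red A M \<Longrightarrow> SN red_obj M"
  and Red_step: "Red A M \<Longrightarrow> red_obj M M' \<Longrightarrow> Red A M'"
  and Red_neutral: "neutral M \<Longrightarrow> (\<And>M'. red_obj M M' \<Longrightarrow> Red A M') \<Longrightarrow> Red A M"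
  using Red_candidate by blast+

section \<open>Reducibility of variables, constants, abstractions and locks\<close>

lemma Red_OVar: "Red A (OVar i)"
  by (rule Red_neutral) (auto elim: red_obj_elims)

lemma Red_OConst: "Red A (OConst c)"
  by (rule Red_neutral) (auto elim: red_obj_elims)

text \<open>An application is neutral, so its reducts suffice: the contractum is reducible by
  hypothesis, the others by induction on normalization of abstraction and argument.\<close>

lemma Red_OLam:
  fixes M :: "('a, 'c, 'p) obj"
  assumes \<sigma>: "SN red_fam \<sigma>" and M: "\<And>N. Red A N \<Longrightarrow> Red B (subst_obj N 0 M)"
  shows "Red (Arr A B) (OLam \<sigma> M)"
  unfolding Red.simps
proof (intro allI impI)
  fix N :: "('a, 'c, 'p) obj"
  assume N: "Red A N"
  have "SN red_obj (subst_obj (OVar 0) 0 M)" by (rule Red_SN[OF M[OF Red_OVar]])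
  then have "SN red_obj M" by (simp only: subst0_eq_psubst SN_psubst_reflect)
  with \<sigma> have "SN red_obj (OLam \<sigma> M)" by (rule SN_OLam)
  moreover have "SN red_obj N" using N by (rule Red_SN)
  \<comment> \<open>The induction generalizes the abstraction to a variable; this invariant retains
    its shape and survives steps in domain and body.\<close>
  moreover have "\<exists>\<sigma>' M'. OLam \<sigma> M = OLam \<sigma>' M' \<and> (\<forall>N. Red A N \<longrightarrow> Red B (subst_obj N 0 M'))"
    using M by blast
  ultimately show "Red B (OApp (OLam \<sigma> M) N)"
    using N
  proof (induction rule: SN_induct2)
    case (step L N)
    from step.prems(1) obtain \<sigma> M where L: "L = OLam \<sigma> M"
      and M: "\<And>N. Red A N \<Longrightarrow> Red B (subst_obj N 0 M)" by blast
    have reducts: "Red B T" if red: "red_obj (OApp L N) T" for T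
    proof -
      consider "T = subst_obj N 0 M" | L' where "red_obj L L'" "T = OApp L' N"
        | N' where "red_obj N N'" "T = OApp L N'"
        using red unfolding L by (auto elim: red_obj_elims(4))
      then show ?thesis
      proof cases
        case 1
        then show ?thesis using M \<open>Red A N\<close> by simp
      next
        case (2 L')
        consider \<sigma>' where "L' = OLam \<sigma>' M" | M' where "L' = OLam \<sigma> M'" "red_obj M M'"
          using 2(1) unfolding L by (auto elim: red_obj_elims(3))
        then have "\<exists>\<sigma>' M'. L' = OLam \<sigma>' M' \<and> (\<forall>N. Red A N \<longrightarrow> Red B (subst_obj N 0 M'))"
        proof cases
          case 1
          then show ?thesis using M by blast
        next
          case (2 M')
          have "Red B (subst_obj N 0 M')" if "Red A N" for N
            using Red_step[OF M[OF that]] red_psubst(2)[OF 2(2)] by (simp add: subst0_eq_psubst)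
          with 2 show ?thesis by blast
        qed
        then show ?thesis using 2 step.IH(1) step.prems(2) by blast
      next
        case (3 N')
        then show ?thesis using step.IH(2) step.prems Red_step by blast
      qed
    qed
    show ?case by (rule Red_neutral[OF _ reducts]) simp
  qed
qed

text \<open>The annotations of unlock and lock reduce independently. Whenever they coincide and the
  predicates agree, the redex contracts to the current body, which is \<open>M\<close> or one of its
  reducts.\<close>

lemma Red_OLock:
  fixes M :: "('a, 'c, 'p) obj"
  assumes "SN red_obj N" "SN red_fam \<sigma>" and M: "Red A M"
  shows "Red (Lk A) (OLock P N \<sigma> M)"
  unfolding Red.simps
proof (intro allI impI)
  fix P' :: 'p and N' :: "('a, 'c, 'p) obj" and \<sigma>' :: "('a, 'c, 'p) fam"
  assume "SN red_obj N'" "SN red_fam \<sigma>'"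
  moreover have "SN red_obj (OLock P N \<sigma> M)" by (intro SN_OLock assms Red_SN[OF M])
  moreover have "\<exists>N'' \<sigma>'' M'. OLock P N \<sigma> M = OLock P N'' \<sigma>'' M' \<and> Red A M'" using M by blast
  ultimately show "Red A (OUnlock P' N' \<sigma>' (OLock P N \<sigma> M))"
  proof (induction rule: SN_induct3)
    case (step N' \<sigma>' L)
    from step.prems obtain N \<sigma> M where L: "L = OLock P N \<sigma> M" and M: "Red A M" by blast
    have lock: "\<exists>N'' \<sigma>'' M'. L' = OLock P N'' \<sigma>'' M' \<and> Red A M'" if "red_obj L L'" for L'
      using that M unfolding L by (auto elim!: red_obj_elims(5) intro: Red_step)
    have reducts: "Red A T" if red: "red_obj (OUnlock P' N' \<sigma>' L) T" for T
    proof -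
      consider "T = M" | N'' where "red_obj N' N''" "T = OUnlock P' N'' \<sigma>' L"
        | \<sigma>'' where "red_fam \<sigma>' \<sigma>''" "T = OUnlock P' N' \<sigma>'' L"
        | L' where "red_obj L L'" "T = OUnlock P' N' \<sigma>' L'"
        using red unfolding L by (auto elim: red_obj_elims(6))
      then show ?thesis
      proof cases
        case 1
        then show ?thesis using M by simp
      qed (use step.IH step.prems lock in blast)+
    qed
    show ?case by (rule Red_neutral[OF _ reducts]) simp
  qed
qed

section \<open>Validity of families\<close>

text \<open>Every step of a family happens inside an object it contains, so dropping objects gives
  an invariant of conversion. \<open>FApp\<close> keeps the erasure of its head, so
  \<open>FConst\<close> is \<open>Base\<close> at every arity.\<close>

primrec erase :: "('a, 'c, 'p) fam \<Rightarrow> sty" where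
  "erase (FConst a) = Base"
| "erase (FPi \<sigma> \<tau>) = Arr (erase \<sigma>) (erase \<tau>)"
| "erase (FApp \<sigma> N) = erase \<sigma>"
| "erase (FLock P N \<sigma> \<rho>) = Lk (erase \<rho>)"

lemma erase_psubst: "erase (psubst_fam \<gamma> \<sigma>) = erase \<sigma>"
  by (induction \<sigma> arbitrary: \<gamma> rule: fam.induct[where ?P2.0 = "\<lambda>_. True"]) simp_all

lemma erase_red: "red_fam \<sigma> \<tau> \<Longrightarrow> erase \<sigma> = erase \<tau>"
  by (induction rule: red_fam_red_obj.inducts(1)[where ?P2.0 = "\<lambda>_ _. True"]) simp_all

lemma erase_equiv: "equivclp red_fam \<sigma> \<tau> \<Longrightarrow> erase \<sigma> = erase \<tau>"
  by (induction rule: equivclp_induct) (auto dest: erase_red)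

text \<open>Hereditary reducibility of a type: it provides the normalizing lock annotations and the
  valid codomains that eliminations need. The environment is kept apart because an instantiated
  codomain is no subterm.\<close>

primrec valid :: "('a, 'c, 'p) fam \<Rightarrow> (nat \<Rightarrow> ('a, 'c, 'p) obj) \<Rightarrow> bool" where
  "valid (FConst a) \<gamma> = True"
| "valid (FPi \<sigma> \<tau>) \<gamma> = (valid \<sigma> \<gamma> \<and> (\<forall>N. Red (erase \<sigma>) N \<longrightarrow> valid \<tau> (case_nat N \<gamma>)))"
| "valid (FApp \<sigma> N) \<gamma> = (valid \<sigma> \<gamma> \<and> SN red_obj (psubst_obj \<gamma> N))"
| "valid (FLock P N \<sigma> \<rho>) \<gamma> = (SN red_obj (psubst_obj \<gamma> N) \<and> valid \<sigma> \<gamma> \<and> valid \<rho> \<gamma>)"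

lemma psubst_case_nat_up:
  "(\<lambda>i. psubst_obj (case_nat N \<gamma>) (up \<delta> i)) = case_nat N (\<lambda>i. psubst_obj \<gamma> (\<delta> i))"
  by (auto simp: up_def fun_eq_iff lift0_eq_psubst psubst_ren split: nat.split)

lemma valid_psubst: "valid (psubst_fam \<delta> \<sigma>) \<gamma> = valid \<sigma> (\<lambda>i. psubst_obj \<gamma> (\<delta> i))"
  by (induction \<sigma> arbitrary: \<gamma> \<delta> rule: fam.induct[where ?P2.0 = "\<lambda>_. True"])
    (simp_all add: psubst_psubst erase_psubst psubst_case_nat_up)

lemma valid_SN: "valid \<sigma> \<gamma> \<Longrightarrow> SN red_fam (psubst_fam \<gamma> \<sigma>)"
proof (induction \<sigma> arbitrary: \<gamma> rule: fam.induct[where ?P2.0 = "\<lambda>_. True"])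
  case (FPi \<sigma> \<tau>)
  \<comment> \<open>Variables are reducible, so one instance of the codomain normalizes; reflection
    then gives the open codomain.\<close>
  then have "SN red_fam (subst_fam (OVar 0) 0 (psubst_fam (up \<gamma>) \<tau>))"
    by (simp add: subst0_psubst_up Red_OVar)
  then have "SN red_fam (psubst_fam (up \<gamma>) \<tau>)"
    by (simp only: subst0_eq_psubst SN_psubst_reflect)
  with FPi show ?case by (simp add: SN_FPi)
qed (simp_all add: SN_FConst SN_FApp SN_FLock)

section \<open>Environments, valid signatures and valid contexts\<close>

text \<open>Reducibility depends only on the erased type, so the variables in an entry need not be
  instantiated.\<close>

definition env :: "('a, 'c, 'p) ctx \<Rightarrow> (nat \<Rightarrow> ('a, 'c, 'p) obj) \<Rightarrow> bool" where
  "env \<Gamma> \<gamma> = (\<forall>i<length \<Gamma>. Red (erase (\<Gamma> ! i)) (\<gamma> i))"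

lemma env_OVar: "env \<Gamma> OVar"
  by (simp add: env_def Red_OVar)

lemma env_Nil: "env [] \<gamma>"
  by (simp add: env_def)

lemma env_Cons: "env (\<sigma> # \<Gamma>) (case_nat N \<gamma>) \<longleftrightarrow> Red (erase \<sigma>) N \<and> env \<Gamma> \<gamma>"
  by (auto simp: env_def nth_Cons split: nat.splits)

lemma env_tail: "env (\<sigma> # \<Gamma>) \<gamma> \<Longrightarrow> env \<Gamma> (\<lambda>i. \<gamma> (Suc i))"
  by (auto simp: env_def)

text \<open>All \<open>\<gamma>\<close> are allowed, since types of constants are checked in the
  empty context, where \<open>env_Nil\<close> admits every \<open>\<gamma>\<close>.\<close>

definition sig_valid :: "('a, 'c, 'p) sig \<Rightarrow> bool" where
  "sig_valid \<Sigma> = (\<forall>c \<sigma> \<gamma>. ObjDecl c \<sigma> \<in> set \<Sigma> \<longrightarrow> valid \<sigma> \<gamma>)"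

primrec ctx_valid :: "('a, 'c, 'p) ctx \<Rightarrow> bool" where
  "ctx_valid [] = True"
| "ctx_valid (\<sigma> # \<Gamma>) = (ctx_valid \<Gamma> \<and> (\<forall>\<gamma>. env \<Gamma> \<gamma> \<longrightarrow> valid \<sigma> \<gamma>))"

text \<open>Entry \<open>i\<close> is relative to the entries after it, so the first
  \<open>i + 1\<close> values of \<open>\<gamma>\<close> are dropped.\<close>

lemma ctx_valid_nth:
  "ctx_valid \<Gamma> \<Longrightarrow> env \<Gamma> \<gamma> \<Longrightarrow> i < length \<Gamma> \<Longrightarrow> valid (\<Gamma> ! i) (\<lambda>j. \<gamma> (j + Suc i))"
proof (induction \<Gamma> arbitrary: \<gamma> i)
  case (Cons \<sigma> \<Gamma>)
  then have "env \<Gamma> (\<lambda>i. \<gamma> (Suc i))" using env_tail by blast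
  with Cons show ?case by (cases i) auto
qed simp

lemma SN_psubst_kind_up:
  assumes "SN red_kind (psubst_kind (case_nat N \<gamma>) K)"
  shows "SN red_kind (psubst_kind (up \<gamma>) K)"
proof (rule SN_psubst_reflect)
  show "SN red_kind (psubst_kind (case_nat N OVar) (psubst_kind (up \<gamma>) K))"
    using assms by (simp add: psubst_kind_psubst_kind case_nat_comp_up)
qed

text \<open>For the guarded unlock rules: the annotations lifted in the premise evaluate in the
  extended environment as in the original one.\<close>

lemma psubst_subst0_lift:
  "psubst_fam (case_nat N \<gamma>) (lift_fam 1 0 \<sigma>) = psubst_fam \<gamma> \<sigma>"
  "psubst_obj (case_nat N \<gamma>) (lift_obj 1 0 M) = psubst_obj \<gamma> M"
  by (simp_all add: lift0_eq_psubst psubst_ren)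

lemma valid_lift: "valid (lift_fam d 0 \<sigma>) \<gamma> = valid \<sigma> (\<lambda>i. \<gamma> (i + d))"
  by (simp add: lift0_eq_psubst valid_psubst)

lemma valid_subst0: "valid (subst_fam N 0 \<sigma>) \<gamma> = valid \<sigma> (case_nat (psubst_obj \<gamma> N) \<gamma>)"
  by (simp add: subst0_eq_psubst valid_psubst psubst_comp_case_nat)

lemma erase_subst0: "erase (subst_fam N 0 \<sigma>) = erase \<sigma>"
  by (simp add: subst0_eq_psubst erase_psubst)

lemma erase_lift0: "erase (lift_fam d 0 \<sigma>) = erase \<sigma>"
  by (simp add: lift0_eq_psubst erase_psubst)

section \<open>The fundamental lemma and normalization\<close>

text \<open>Validity of the lock type normalizes its annotations, so the clause for
  \<open>Lk\<close> applies. The unlocked object may thus be the value of the variable removed by a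
  guarded rule.\<close>

lemma Red_unlock_guard:
  assumes "valid (FLock P S \<sigma> \<tau>) \<gamma>" "Red (erase (FLock P S \<sigma> \<tau>)) (psubst_obj \<gamma> N)"
  shows "Red (erase \<tau>) (psubst_obj \<gamma> (OUnlock P S \<sigma> N))"
  using assms by (simp add: valid_SN)

text \<open>All environments are treated at once because binders extend them. Validity of signature
  and context is carried along for constants and variables, and validity of the type of an object
  for the elimination rules.\<close>

lemma fundamental:
  fixes holds :: "'p \<Rightarrow> ('a, 'c, 'p) judgement \<Rightarrow> bool"
  shows "sig_ok holds \<Sigma> \<Longrightarrow> sig_valid \<Sigma>"
    and "ctx_ok holds \<Sigma> \<Gamma> \<Longrightarrow> sig_valid \<Sigma> \<and> ctx_valid \<Gamma>"
    and "kind_ok holds \<Sigma> \<Gamma> K \<Longrightarrow> sig_valid \<Sigma> \<and> ctx_valid \<Gamma> \<and>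
      (\<forall>\<gamma>. env \<Gamma> \<gamma> \<longrightarrow> SN red_kind (psubst_kind \<gamma> K))"
    and "has_kind holds \<Sigma> \<Gamma> \<sigma> K \<Longrightarrow> sig_valid \<Sigma> \<and> ctx_valid \<Gamma> \<and>
      (\<forall>\<gamma>. env \<Gamma> \<gamma> \<longrightarrow> valid \<sigma> \<gamma>)"
    and "has_type holds \<Sigma> \<Gamma> M \<sigma> \<Longrightarrow> sig_valid \<Sigma> \<and> ctx_valid \<Gamma> \<and>
      (\<forall>\<gamma>. env \<Gamma> \<gamma> \<longrightarrow> valid \<sigma> \<gamma> \<and> Red (erase \<sigma>) (psubst_obj \<gamma> M))"
proof (induction rule: sig_ok_ctx_ok_kind_ok_has_kind_has_type.inducts)
  case S_Empty
  then show ?case by (simp add: sig_valid_def)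
next
  case (S_Kind \<Sigma> K a)
  then show ?case by (auto simp: sig_valid_def)
next
  case (S_Type \<Sigma> \<sigma> c)
  then show ?case by (auto simp: sig_valid_def env_Nil)
next
  case (K_Type \<Sigma> \<Gamma>)
  then show ?case by (simp add: SN_KType)
next
  case (K_Pi \<Sigma> \<sigma> \<Gamma> K)
  have "SN red_kind (psubst_kind \<gamma> (KPi \<sigma> K))" if "env \<Gamma> \<gamma>" for \<gamma>
  proof -
    \<comment> \<open>The body is tested at a variable and reflected; the domain normalizes by
      validity of the extended context.\<close>
    have "env (\<sigma> # \<Gamma>) (case_nat (OVar 0) \<gamma>)" using that by (simp add: env_Cons Red_OVar)
    with K_Pi that show ?thesis by (auto intro!: SN_KPi valid_SN intro: SN_psubst_kind_up)
  qed
  with K_Pi show ?case by simp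
next
  case (F_Pi \<Sigma> \<sigma> \<Gamma> \<tau>)
  then show ?case by (simp add: env_Cons)
next
  case (F_App \<Sigma> \<Gamma> \<sigma> \<tau> K N)
  then show ?case by (auto intro: Red_SN)
next
  case (F_Lock \<Sigma> \<Gamma> \<rho> N \<sigma> P)
  then show ?case by (auto intro: Red_SN)
next
  case (F_Guarded_Unlock \<Sigma> \<tau> \<Gamma> P S \<sigma> \<rho> N S' \<sigma>')
  have "valid (FLock P S \<sigma> (subst_fam (OUnlock P S' \<sigma>' N) 0 \<rho>)) \<gamma>" if "env \<Gamma> \<gamma>" for \<gamma>
  proof -
    \<comment> \<open>With the unlocked object as value of the removed variable, the premise in
      \<open>\<delta>\<close> is the conclusion in \<open>\<gamma>\<close>.\<close>
    define \<delta> where "\<delta> = case_nat (psubst_obj \<gamma> (OUnlock P S' \<sigma>' N)) \<gamma>"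
    have "valid (FLock P S' \<sigma>' \<tau>) \<gamma>" "Red (erase (FLock P S' \<sigma>' \<tau>)) (psubst_obj \<gamma> N)"
      using F_Guarded_Unlock.IH that by blast+
    from Red_unlock_guard[OF this] that have "env (\<tau> # \<Gamma>) \<delta>"
      unfolding \<delta>_def env_Cons by (rule conjI)
    then have "valid (FLock P (lift_obj 1 0 S) (lift_fam 1 0 \<sigma>) \<rho>) \<delta>"
      using F_Guarded_Unlock.IH by blast
    then show ?thesis
      unfolding valid.simps valid_lift valid_subst0 \<delta>_def psubst_subst0_lift by simp
  qed
  with F_Guarded_Unlock show ?case by simp
next
  case (O_Const \<Sigma> \<Gamma> c \<sigma>)
  then show ?case by (auto simp: sig_valid_def Red_OConst)
next
  case (O_Var \<Sigma> \<Gamma> i)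
  have "valid (lift_fam (Suc i) 0 (\<Gamma> ! i)) \<gamma>" if "env \<Gamma> \<gamma>" for \<gamma>
    using O_Var that ctx_valid_nth[of \<Gamma> \<gamma> i] by (simp only: valid_lift)
  with O_Var show ?case by (auto simp: erase_lift0 env_def)
next
  case (O_Abs \<Sigma> \<sigma> \<Gamma> M \<tau>)
  then show ?case by (auto simp: env_Cons subst0_psubst_up simp del: Red.simps
        intro!: Red_OLam valid_SN)
next
  case (O_App \<Sigma> \<Gamma> M \<sigma> \<tau> N)
  \<comment> \<open>Validity of the product type at the reducible argument is validity of the result
    type.\<close>
  then show ?case by (simp add: valid_subst0 erase_subst0)
next
  case (O_Conv \<Sigma> \<Gamma> M \<sigma> \<tau>)
  \<comment> \<open>Convertible families have equal erasures, which transports reducibility;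
    validity of \<open>\<tau>\<close> comes from its kinding.\<close>
  then show ?case using erase_equiv by metis
next
  case (O_Lock \<Sigma> \<Gamma> M \<rho> N \<sigma> P)
  then show ?case by (auto simp del: Red.simps intro!: Red_OLock valid_SN intro: Red_SN)
next
  case (O_Top_Unlock \<Sigma> \<Gamma> M P N \<sigma> \<rho>)
  \<comment> \<open>The valid lock type of \<open>M\<close> supplies normalization of
    \<open>N\<close> and \<open>\<sigma>\<close>, at which reducibility of \<open>M\<close> is
    instantiated.\<close>
  then show ?case by (simp add: valid_SN)
next
  case (O_Guarded_Unlock \<Sigma> \<tau> \<Gamma> P S \<sigma> M \<rho> N S' \<sigma>')
  have "valid (FLock P S \<sigma> (subst_fam (OUnlock P S' \<sigma>' N) 0 \<rho>)) \<gamma> \<and>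
      Red (erase (FLock P S \<sigma> (subst_fam (OUnlock P S' \<sigma>' N) 0 \<rho>)))
        (psubst_obj \<gamma> (OLock P S \<sigma> (subst_obj (OUnlock P S' \<sigma>' N) 0 M)))"
    if "env \<Gamma> \<gamma>" for \<gamma>
  proof -
    define \<delta> where "\<delta> = case_nat (psubst_obj \<gamma> (OUnlock P S' \<sigma>' N)) \<gamma>"
    have "valid (FLock P S' \<sigma>' \<tau>) \<gamma>" "Red (erase (FLock P S' \<sigma>' \<tau>)) (psubst_obj \<gamma> N)"
      using O_Guarded_Unlock.IH that by blast+
    from Red_unlock_guard[OF this] that have "env (\<tau> # \<Gamma>) \<delta>"
      unfolding \<delta>_def env_Cons by (rule conjI)
    then have "valid (FLock P (lift_obj 1 0 S) (lift_fam 1 0 \<sigma>) \<rho>) \<delta>"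
      "Red (Lk (erase \<rho>)) (psubst_obj \<delta> (OLock P (lift_obj 1 0 S) (lift_fam 1 0 \<sigma>) M))"
      using O_Guarded_Unlock.IH by auto
    \<comment> \<open>The lock of the premise in \<open>\<delta>\<close> is the lock of the
      conclusion in \<open>\<gamma>\<close>, so its reducibility carries over as a whole.\<close>
    then show ?thesis
      unfolding valid.simps valid_lift valid_subst0 \<delta>_def psubst_obj.simps(5) erase.simps erase_subst0
        psubst_subst0_lift psubst_subst0
      by (simp del: Red.simps)
  qed
  with O_Guarded_Unlock show ?case by blast
qed simp_all

theorem theorem4p2:
  fixes holds :: "'p \<Rightarrow> ('a, 'c, 'p) judgement \<Rightarrow> bool"
  shows "(\<forall>\<Sigma> \<Gamma> K. kind_ok holds \<Sigma> \<Gamma> K \<longrightarrow> termip red_kind K) \<and>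
         (\<forall>\<Sigma> \<Gamma> \<sigma> K. has_kind holds \<Sigma> \<Gamma> \<sigma> K \<longrightarrow> termip red_fam \<sigma>) \<and>
         (\<forall>\<Sigma> \<Gamma> M \<sigma>. has_type holds \<Sigma> \<Gamma> M \<sigma> \<longrightarrow> termip red_obj M)"
proof (intro conjI allI impI)
  fix \<Sigma> \<Gamma> K
  assume "kind_ok holds \<Sigma> \<Gamma> K"
  then show "termip red_kind K"
    \<comment> \<open>Variables are reducible, so the identity substitution is an environment for
      every context.\<close>
    unfolding SN_def[symmetric] using fundamental(3) env_OVar psubst_kind_OVar by metis
next
  fix \<Sigma> \<Gamma> \<sigma> K
  assume "has_kind holds \<Sigma> \<Gamma> \<sigma> K"
  then show "termip red_fam \<sigma>"
    unfolding SN_def[symmetric] using fundamental(4) env_OVar valid_SN psubst_OVar(1) by metis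
next
  fix \<Sigma> \<Gamma> M \<sigma>
  assume "has_type holds \<Sigma> \<Gamma> M \<sigma>"
  then show "termip red_obj M"
    unfolding SN_def[symmetric] using fundamental(5) env_OVar Red_SN psubst_OVar(2) by metis
qed

end
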